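(* Let $\gamma,\alpha\in(0,1)$, let $\theta_1,\dots,\theta_m$ be i.i.d. Bernoulli$(\pi)$, and let $\boldsymbol Z=(Z_1,\dots,Z_m)$ satisfy $\boldsymbol Z\mid\boldsymbol\theta\sim\mathcal N(\mu\,\boldsymbol\theta,\Sigma)$, where $\mu\in\mathbb{R}$ is a common mean and $\Sigma$ is the equicorrelated matrix with $\Sigma_{ii}=1$ and $\Sigma_{ij}=\rho$ for $i\ne j$, with $\rho\in[0,1)$. Then ranking by the local false discovery rate (the ranking used by Procedure 1) is optimal in the following sense: for every decision rule $\boldsymbol\delta$ satisfying $$\mathbb{P}\left(\frac{\sum_{i=1}^m(1-\theta_i)\delta_i}{\max\{\sum_{i=1}^m\delta_i,1\}}>\gamma\right)\le\alpha,$$ there exists an lfdr-based thresholding rule $\boldsymbol\delta'$ that also satisfies $$\mathbb{P}\left(\frac{\sum_{i=1}^m(1-\theta_i)\delta'_i}{\max\{\sum_{i=1}^m\delta'_i,1\}}>\gamma\right)\le\alpha$$ and such that $$\mathbb{E}\left(\sum_{i=1}^m\theta_i\delta_i'\right)\ \ge\ \mathbb{E}\left(\sum_{i=1}^m\theta_i\delta_i\right).$$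
   Context: Here $\boldsymbol\theta=(\theta_i)_{i\in[m]}\in\{0,1\}^m$, $[m]=\{1,\dots,m\}$, and $\theta_i=0$ means the $i$-th null hypothesis is true. The (marginal) local false discovery rate of unit $i$ is $T_i^{OR}=\mathbb{P}(\theta_i=0\mid Z_i)=(1-\pi)f_0(Z_i)/f(Z_i)$, where $f_0$ and $f_1$ are the densities of $Z_i$ given $\theta_i=0$ and $\theta_i=1$ respectively, and $f=(1-\pi)f_0+\pi f_1$. A decision rule is a vector $\boldsymbol\delta=(\delta_i)_{i\in[m]}\in\{0,1\}^m$ that is a measurable function of $\boldsymbol Z$, possibly together with an auxiliary randomization variable independent of $(\boldsymbol\theta,\boldsymbol Z)$; $\delta_i=1$ means that the $i$-th null is rejected. An lfdr-based thresholding rule is a decision rule that orders the hypotheses by increasing $T_i^{OR}$ (ties broken arbitrarily) and rejects the first $k$ of them, where $k\in\{0,1,\dots,m\}$ may depend on the data $\boldsymbol Z$ (and on the auxiliary randomization variable). The expected number of true positives (ETP), used as the measure of power, is $\mathbb{E}(\sum_i\theta_i\delta_i)$. *)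

theory Defs
  imports "HOL-Probability.Probability"
begin

text \<open>The index set \<open>[m]\<close> is the finite type \<open>'n\<close>, with \<open>m = CARD('n)\<close>.  An element of
  \<open>{0,1}\<^sup>m\<close> is a function \<open>'n \<Rightarrow> bool\<close>, where \<open>True\<close> stands for 1.\<close>

text \<open>Meaningful for symmetric positive definite \<open>S\<close> only.\<close>

definition mvn_density :: "real^'n \<Rightarrow> real^'n^'n \<Rightarrow> real^'n::finite \<Rightarrow> real" where
  "mvn_density a S x =
     exp (- ((x - a) \<bullet> (matrix_inv S *v (x - a))) / 2) / sqrt ((2 * pi) ^ CARD('n) * det S)"

definition equicorrelated :: "real \<Rightarrow> real^'n^'n::finite" where
  "equicorrelated \<rho> = (\<chi> i j. if i = j then 1 else \<rho>)"

text \<open>\<open>uniform_measure M A\<close> is \<open>M\<close> conditioned on the event \<open>A\<close>; conditional laws are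
  required for events of positive probability only.\<close>

definition has_cond_density ::
    "'w measure \<Rightarrow> ('w \<Rightarrow> bool) \<Rightarrow> ('w \<Rightarrow> 'b::euclidean_space) \<Rightarrow> ('b \<Rightarrow> real) \<Rightarrow> bool" where
  "has_cond_density M P X f \<longleftrightarrow> (\<forall>x. 0 \<le> f x) \<and>
     (0 < \<P>(\<omega> in M. P \<omega>) \<longrightarrow>
        distributed (uniform_measure M {\<omega> \<in> space M. P \<omega>}) lborel X (\<lambda>x. ennreal (f x)))"

definition iid_bernoulli :: "'w measure \<Rightarrow> real \<Rightarrow> ('w \<Rightarrow> 'n::finite \<Rightarrow> bool) \<Rightarrow> bool" where
  "iid_bernoulli M \<pi> \<theta> \<longleftrightarrow>
     prob_space.indep_vars M (\<lambda>_. count_space UNIV) (\<lambda>i \<omega>. \<theta> \<omega> i) UNIV \<and>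
     (\<forall>i. distr M (count_space UNIV) (\<lambda>\<omega>. \<theta> \<omega> i) = measure_pmf (bernoulli_pmf \<pi>))"

definition cond_gaussian ::
    "'w measure \<Rightarrow> real \<Rightarrow> real^'n^'n \<Rightarrow> ('w \<Rightarrow> 'n::finite \<Rightarrow> bool) \<Rightarrow> ('w \<Rightarrow> real^'n) \<Rightarrow> bool" where
  "cond_gaussian M \<mu> S \<theta> Z \<longleftrightarrow> Z \<in> borel_measurable M \<and>
     (\<forall>t. has_cond_density M (\<lambda>\<omega>. \<theta> \<omega> = t) Z (mvn_density (\<mu> *\<^sub>R (\<chi> i. of_bool (t i))) S))"

definition lfdr :: "real \<Rightarrow> (real \<Rightarrow> real) \<Rightarrow> (real \<Rightarrow> real) \<Rightarrow> real \<Rightarrow> real" where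
  "lfdr \<pi> f0 f1 x = (1 - \<pi>) * f0 x / ((1 - \<pi>) * f0 x + \<pi> * f1 x)"

text \<open>Like \<open>indep_var\<close>, which requires both variables to have values in the same type.\<close>

definition indep_rvs ::
    "'w measure \<Rightarrow> 'a measure \<Rightarrow> ('w \<Rightarrow> 'a) \<Rightarrow> 'b measure \<Rightarrow> ('w \<Rightarrow> 'b) \<Rightarrow> bool" where
  "indep_rvs M S X T Y \<longleftrightarrow> X \<in> M \<rightarrow>\<^sub>M S \<and> Y \<in> M \<rightarrow>\<^sub>M T \<and>
     prob_space.indep_set M (sets (vimage_algebra (space M) X S))
       (sets (vimage_algebra (space M) Y T))"

text \<open>The auxiliary randomization variable \<open>U\<close> takes values in the measurable space \<open>N\<close>;
  a constant \<open>U\<close> gives the non-randomized rules.\<close>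

definition decision_rule ::
    "'w measure \<Rightarrow> 'u measure \<Rightarrow> ('w \<Rightarrow> 'n::finite \<Rightarrow> bool) \<Rightarrow> ('w \<Rightarrow> real^'n)
      \<Rightarrow> ('w \<Rightarrow> 'n \<Rightarrow> bool) \<Rightarrow> bool" where
  "decision_rule M N \<theta> Z \<delta> \<longleftrightarrow>
     (\<exists>U d. indep_rvs M (count_space UNIV \<Otimes>\<^sub>M borel) (\<lambda>\<omega>. (\<theta> \<omega>, Z \<omega>)) N U \<and>
            d \<in> borel \<Otimes>\<^sub>M N \<rightarrow>\<^sub>M count_space UNIV \<and>
            (\<forall>\<omega>\<in>space M. \<delta> \<omega> = d (Z \<omega>, U \<omega>)))"

text \<open>\<open>\<sigma> 0, \<sigma> 1, \<dots>\<close> lists the hypotheses by increasing score \<open>T\<close>, with any order among ties.\<close>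

definition rejects_first :: "('n::finite \<Rightarrow> real) \<Rightarrow> nat \<Rightarrow> ('n \<Rightarrow> bool) \<Rightarrow> bool" where
  "rejects_first T k r \<longleftrightarrow>
     (\<exists>\<sigma>. bij_betw \<sigma> {..<CARD('n)} UNIV \<and> mono_on {..<CARD('n)} (\<lambda>j. T (\<sigma> j)) \<and>
          {i. r i} = \<sigma> ` {..<k})"

text \<open>The number \<open>k\<close> depends on the outcome only through the data and the randomization
  variable, because it is the number of rejections of a decision rule.\<close>

definition lfdr_thresholding_rule ::
    "'w measure \<Rightarrow> 'u measure \<Rightarrow> ('w \<Rightarrow> 'n::finite \<Rightarrow> bool) \<Rightarrow> ('w \<Rightarrow> real^'n)
      \<Rightarrow> real \<Rightarrow> (real \<Rightarrow> real) \<Rightarrow> (real \<Rightarrow> real) \<Rightarrow> ('w \<Rightarrow> 'n \<Rightarrow> bool) \<Rightarrow> bool" where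
  "lfdr_thresholding_rule M N \<theta> Z \<pi> f0 f1 \<delta> \<longleftrightarrow> decision_rule M N \<theta> Z \<delta> \<and>
     (\<forall>\<omega>\<in>space M. \<exists>k\<le>CARD('n). rejects_first (\<lambda>i. lfdr \<pi> f0 f1 (Z \<omega> $ i)) k (\<delta> \<omega>))"

definition fdp :: "('n::finite \<Rightarrow> bool) \<Rightarrow> ('n \<Rightarrow> bool) \<Rightarrow> real" where
  "fdp t r = (\<Sum>i\<in>UNIV. (1 - of_bool (t i)) * of_bool (r i)) / max (\<Sum>i\<in>UNIV. of_bool (r i)) 1"

definition etp :: "'w measure \<Rightarrow> ('w \<Rightarrow> 'n::finite \<Rightarrow> bool) \<Rightarrow> ('w \<Rightarrow> 'n \<Rightarrow> bool) \<Rightarrow> real" where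
  "etp M \<theta> \<delta> = (\<integral>\<omega>. (\<Sum>i\<in>UNIV. of_bool (\<theta> \<omega> i) * of_bool (\<delta> \<omega> i)) \<partial>M)"

end

theory Submission
  imports Defs
begin

text \<open>Write \<open>p\<^sub>t\<close> for the density of \<open>Z\<close> given \<open>\<theta> = t\<close> and let the posterior weight of \<open>t\<close> at \<open>z\<close> be
  \<open>\<P>(\<theta> = t) p\<^sub>t(z)\<close>.  If \<open>t i = 1\<close>, \<open>t j = 0\<close> and \<open>\<mu> z\<^sub>j \<le> \<mu> z\<^sub>i\<close>, then exchanging the entries \<open>i\<close> and \<open>j\<close>
  of \<open>t\<close> does not increase the weight, because \<open>e\<^sub>i - e\<^sub>j\<close> is an eigenvector of \<open>\<Sigma>\<close>.  Moreover
  \<open>f\<^sub>1(x) = f\<^sub>0(x) exp (\<mu> x - \<mu>\<^sup>2 / 2)\<close> almost everywhere if \<open>0 < \<pi> < 1\<close>, so the lfdr ranking is then the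
  ranking by decreasing \<open>\<mu> z\<^sub>i\<close>; if \<open>\<pi> \<in> {0, 1}\<close>, the weight of such a \<open>t\<close> is 0.  Hence, given the
  data, replacing a rejected hypothesis by a non-rejected one of smaller lfdr makes the number of
  true positives stochastically larger.  The rule \<open>\<delta>'\<close> rejects as many hypotheses as \<open>\<delta>\<close>, those of
  smallest lfdr.\<close>

subsection \<open>Exchange argument and sorted rejection sets\<close>

definition swapping_monotone :: "('n \<Rightarrow> real) \<Rightarrow> (('n \<Rightarrow> bool) \<Rightarrow> real) \<Rightarrow> bool" where
  "swapping_monotone T w \<longleftrightarrow>
     (\<forall>i j t. T i \<le> T j \<longrightarrow> t i \<longrightarrow> \<not> t j \<longrightarrow> w (t \<circ> Transposition.transpose i j) \<le> w t)"

definition criterion :: "(nat \<Rightarrow> nat \<Rightarrow> real) \<Rightarrow> ('n::finite \<Rightarrow> bool) \<Rightarrow> ('n \<Rightarrow> bool) \<Rightarrow> real" where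
  "criterion G t r = G (card {i. r i}) (card {i. r i \<and> t i})"

lemma card_Collect_le: "card {i. P i} \<le> CARD('n)" for P :: "'n::finite \<Rightarrow> bool"
  by (rule card_mono) auto

lemma Collect_comp_bij:
  assumes "bij s" shows "{i. P (s i)} = inv s ` {i. P i}"
proof -
  have "{i. P (s i)} = s -` Collect P" by auto
  then show ?thesis by (simp only: bij_vimage_eq_inv_image[OF assms])
qed

lemma card_comp_bij:
  assumes "bij s" shows "card {i. P (s i)} = card {i. P i}"
  unfolding Collect_comp_bij[OF assms]
  by (rule card_image) (meson assms bij_imp_bij_inv bij_is_inj inj_on_subset subset_UNIV)

lemma criterion_comp_bij:
  assumes "bij s" shows "criterion G (t \<circ> s) (r \<circ> s) = criterion G t r"
  unfolding criterion_def comp_def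
  using card_comp_bij[OF assms, of r] card_comp_bij[OF assms, of "\<lambda>i. r i \<and> t i"] by simp

lemma sum_swap_le:
  fixes w :: "('n::finite \<Rightarrow> bool) \<Rightarrow> real"
  assumes w: "swapping_monotone T w" and G: "\<And>k. antimono (G k)"
    and r: "r j" "\<not> r i" and T: "T i \<le> T j"
  defines "s \<equiv> Transposition.transpose i j"
  shows "(\<Sum>t\<in>UNIV. w t * criterion G t (r \<circ> s)) \<le> (\<Sum>t\<in>UNIV. w t * criterion G t r)"
proof -
  have s: "bij s" "s \<circ> s = id"
    unfolding s_def by auto
  have ne: "i \<noteq> j" using r by auto
  have inv: "bij (\<lambda>t::'n \<Rightarrow> bool. t \<circ> s)"
    by (rule involuntory_imp_bij) (simp add: comp_assoc s(2))
  have reindex: "(\<Sum>t\<in>UNIV. f (t \<circ> s)) = (\<Sum>t\<in>UNIV. f t)" for f :: "('n \<Rightarrow> bool) \<Rightarrow> real"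
    using sum.reindex_bij_betw[OF inv, of f] by simp
  have crit_swap: "criterion G (t \<circ> s) r = criterion G t (r \<circ> s)" for t
    using criterion_comp_bij[OF s(1), of G t "r \<circ> s"] by (simp add: comp_assoc s(2))
  have crit_swap': "criterion G (t \<circ> s) (r \<circ> s) = criterion G t r" for t
    by (rule criterion_comp_bij[OF s(1)])
  have rs: "r (s x) \<longleftrightarrow> (if x = i then True else if x = j then False else r x)" for x
    using r by (auto simp: s_def Transposition.transpose_def)
  have cr: "card {x. (r \<circ> s) x} = card {x. r x}"
    unfolding comp_def by (rule card_comp_bij[OF s(1)])
  have le: "criterion G t (r \<circ> s) \<le> criterion G t r" if "t i" "\<not> t j" for t
  proof -
    have "{x. r x \<and> t x} \<subseteq> {x. (r \<circ> s) x \<and> t x}"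
      using that r by (auto simp: rs)
    then have "card {x. r x \<and> t x} \<le> card {x. (r \<circ> s) x \<and> t x}"
      by (rule card_mono[rotated]) simp
    with G[of "card {x. r x}"] show ?thesis
      unfolding criterion_def cr by (simp add: antimono_def)
  qed
  have ts: "t \<circ> s \<circ> s = t" for t :: "'n \<Rightarrow> bool"
    by (simp add: comp_assoc s(2))
  have pointwise: "w t * criterion G t (r \<circ> s) + w (t \<circ> s) * criterion G t r
      \<le> w t * criterion G t r + w (t \<circ> s) * criterion G t (r \<circ> s)" for t
  proof -
    have "0 \<le> (w t - w (t \<circ> s)) * (criterion G t r - criterion G t (r \<circ> s))"
    proof (cases "t i = t j")
      case True
      then have "t \<circ> s = t" by (auto simp: fun_eq_iff s_def Transposition.transpose_def)
      then show ?thesis by simp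
    next
      case False
      show ?thesis
      proof (cases "t i")
        case True
        with False have t: "t i" "\<not> t j" by auto
        have "w (t \<circ> s) \<le> w t"
          using w T t unfolding swapping_monotone_def s_def by blast
        then show ?thesis using le[OF t] by simp
      next
        case t: False
        have t': "(t \<circ> s) i" "\<not> (t \<circ> s) j"
          using t False by (auto simp: s_def)
        have "w (t \<circ> s \<circ> s) \<le> w (t \<circ> s)"
          using w T t' unfolding swapping_monotone_def s_def by blast
        moreover have "criterion G t r \<le> criterion G t (r \<circ> s)"
          using le[OF t'] by (simp only: crit_swap crit_swap')
        ultimately show ?thesis by (simp add: ts mult_nonpos_nonpos)
      qed
    qed
    then show ?thesis by (simp add: algebra_simps)
  qed
  have "2 * (\<Sum>t\<in>UNIV. w t * criterion G t (r \<circ> s))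
      = (\<Sum>t\<in>UNIV. w t * criterion G t (r \<circ> s) + w (t \<circ> s) * criterion G t r)"
    using reindex[of "\<lambda>t. w t * criterion G t (r \<circ> s)"] by (simp add: sum.distrib crit_swap')
  also have "\<dots> \<le> (\<Sum>t\<in>UNIV. w t * criterion G t r + w (t \<circ> s) * criterion G t (r \<circ> s))"
    by (rule sum_mono) (rule pointwise)
  also have "\<dots> = 2 * (\<Sum>t\<in>UNIV. w t * criterion G t r)"
    using reindex[of "\<lambda>t. w t * criterion G t r"] by (simp add: sum.distrib crit_swap)
  finally show ?thesis by simp
qed

lemma sum_first_le:
  fixes w :: "('n::finite \<Rightarrow> bool) \<Rightarrow> real"
  assumes w: "swapping_monotone T w" and G: "\<And>k. antimono (G k)"
    and r0: "\<And>i j. r0 i \<Longrightarrow> \<not> r0 j \<Longrightarrow> T i \<le> T j" and "card {i. r0 i} = card {i. r i}"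
  shows "(\<Sum>t\<in>UNIV. w t * criterion G t r0) \<le> (\<Sum>t\<in>UNIV. w t * criterion G t r)"
  using assms(4)
proof (induction "card {i. r i \<and> \<not> r0 i}" arbitrary: r rule: less_induct)
  case less
  show ?case
  proof (cases "{i. r i \<and> \<not> r0 i} = {}")
    case True
    then have "{i. r i} \<subseteq> {i. r0 i}" by auto
    then have "{i. r i} = {i. r0 i}"
      by (rule card_subset_eq[rotated]) (auto simp: less.prems)
    then have "r = r0" by auto
    then show ?thesis by simp
  next
    case False
    then obtain j where j: "r j" "\<not> r0 j" by auto
    have "\<not> {i. r0 i} \<subseteq> {i. r i}"
    proof
      assume "{i. r0 i} \<subseteq> {i. r i}"
      then have "{i. r0 i} = {i. r i}"
        by (rule card_subset_eq[rotated]) (auto simp: less.prems)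
      with j show False by auto
    qed
    then obtain i where i: "r0 i" "\<not> r i" by auto
    define s where "s = Transposition.transpose i j"
    have rs: "r (s x) \<longleftrightarrow> (if x = i then True else if x = j then False else r x)" for x
      using i j by (auto simp: s_def Transposition.transpose_def)
    have "{x. (r \<circ> s) x \<and> \<not> r0 x} \<subset> {x. r x \<and> \<not> r0 x}"
      using i j by (auto simp: rs split: if_splits)
    then have 1: "card {x. (r \<circ> s) x \<and> \<not> r0 x} < card {x. r x \<and> \<not> r0 x}"
      by (rule psubset_card_mono[rotated]) simp
    have 2: "card {x. r0 x} = card {x. (r \<circ> s) x}"
      unfolding less.prems comp_def by (rule card_comp_bij[symmetric]) (simp add: s_def)
    have "(\<Sum>t\<in>UNIV. w t * criterion G t r0) \<le> (\<Sum>t\<in>UNIV. w t * criterion G t (r \<circ> s))"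
      by (rule less.hyps[OF 1 2])
    also have "\<dots> \<le> (\<Sum>t\<in>UNIV. w t * criterion G t r)"
      unfolding s_def by (rule sum_swap_le[OF w G]) (use i j r0 in auto)
    finally show ?thesis .
  qed
qed

definition precedes :: "('n::finite \<Rightarrow> real) \<Rightarrow> 'n \<Rightarrow> 'n \<Rightarrow> bool" where
  "precedes T i j \<longleftrightarrow> T i < T j \<or> T i = T j \<and> to_nat_on UNIV i < to_nat_on UNIV j"

definition position :: "('n::finite \<Rightarrow> real) \<Rightarrow> 'n \<Rightarrow> nat" where
  "position T i = card {j. precedes T j i}"

lemma position_strict: assumes "precedes T i j" shows "position T i < position T j"
  unfolding position_def
proof (rule psubset_card_mono)
  show "{k. precedes T k i} \<subset> {k. precedes T k j}"
    using assms by (auto simp: precedes_def)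
qed simp

lemma precedes_total: "(i::'n::finite) \<noteq> j \<Longrightarrow> precedes T i j \<or> precedes T j i"
proof -
  assume "i \<noteq> j"
  then have "to_nat_on (UNIV :: 'n set) i \<noteq> to_nat_on UNIV j"
    by (simp add: countable_finite)
  then have "to_nat_on (UNIV :: 'n set) i < to_nat_on UNIV j \<or> to_nat_on (UNIV :: 'n set) j < to_nat_on UNIV i"
    by linarith
  then show ?thesis by (auto simp: precedes_def)
qed

lemma position_le_imp: "position T i \<le> position T j \<Longrightarrow> T i \<le> T j"
  using position_strict[of T j i] by (force simp: precedes_def)

lemma bij_betw_position: "bij_betw (position T) (UNIV::'n::finite set) {..<CARD('n)}"
proof -
  have inj: "inj (position T)"
  proof (rule injI, rule ccontr)
    fix i j assume "position T i = position T j" "i \<noteq> j"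
    then show False
      using precedes_total[of i j T] position_strict[of T i j] position_strict[of T j i] by auto
  qed
  have "position T i < CARD('n)" for i
    unfolding position_def by (rule psubset_card_mono) (auto simp: precedes_def)
  then have "range (position T) \<subseteq> {..<CARD('n)}" by auto
  moreover have "card (range (position T)) = card {..<CARD('n)}"
    by (simp add: card_image[OF inj])
  ultimately have "range (position T) = {..<CARD('n)}"
    by (intro card_subset_eq) auto
  with inj show ?thesis by (simp add: bij_betw_def)
qed

lemma position_less_image:
  assumes "k \<le> CARD('n)"
  shows "{i::'n::finite. position T i < k} = the_inv_into UNIV (position T) ` {..<k}"
proof -
  note b = bij_betw_position[of T] 
  have inj: "inj (position T)" using b by (simp add: bij_betw_def)
  have ran: "range (position T) = {..<CARD('n)}" using b by (simp add: bij_betw_def)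
  show ?thesis
  proof (intro equalityI subsetI)
    fix i assume "i \<in> {i. position T i < k}"
    then show "i \<in> the_inv_into UNIV (position T) ` {..<k}"
      by (intro image_eqI[of _ _ "position T i"]) (auto simp: the_inv_into_f_f[OF inj])
  next
    fix i assume "i \<in> the_inv_into UNIV (position T) ` {..<k}"
    then obtain l where l: "l < k" "i = the_inv_into UNIV (position T) l" by auto
    then have "l \<in> range (position T)" unfolding ran using assms by simp
    then have "position T i = l" unfolding l by (rule f_the_inv_into_f[OF inj])
    with l show "i \<in> {i. position T i < k}" by simp
  qed
qed

lemma rejects_first_position:
  assumes "k \<le> CARD('n)"
  shows "rejects_first T k (\<lambda>i::'n::finite. position T i < k)"
  unfolding rejects_first_def
proof (intro exI conjI)
  let ?s = "the_inv_into UNIV (position T)"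
  note b = bij_betw_position[of T]
  have inj: "inj (position T)" and ran: "range (position T) = {..<CARD('n)}"
    using b by (auto simp: bij_betw_def)
  show "bij_betw ?s {..<CARD('n)} UNIV"
    using bij_betw_the_inv_into[OF b] .
  show "{i. position T i < k} = ?s ` {..<k}"
    by (rule position_less_image[OF assms])
  show "mono_on {..<CARD('n)} (\<lambda>j. T (?s j))"
  proof (rule mono_onI)
    fix a b assume "a \<in> {..<CARD('n)}" "b \<in> {..<CARD('n)}" "a \<le> b"
    then have "position T (?s a) \<le> position T (?s b)"
      using f_the_inv_into_f[OF inj, unfolded ran] by simp
    then show "T (?s a) \<le> T (?s b)" by (rule position_le_imp)
  qed
qed

lemma card_position_less:
  assumes "k \<le> CARD('n)"
  shows "card {i::'n::finite. position T i < k} = k"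
proof -
  have "inj_on (the_inv_into UNIV (position T)) {..<k}"
    using bij_betw_the_inv_into[OF bij_betw_position[of T]] assms
    by (auto simp: bij_betw_def intro: inj_on_subset)
  then show ?thesis unfolding position_less_image[OF assms] by (simp add: card_image)
qed

subsection \<open>Equicorrelated Gaussian densities\<close>

lemma equicorrelated_mult_vec:
  "equicorrelated \<rho> *v x = (\<chi> i. (1 - \<rho>) * x $ i + \<rho> * (\<Sum>j\<in>UNIV. x $ j))"
proof -
  have "(\<Sum>j\<in>UNIV. (if i = j then 1 else \<rho>) * x $ j) = (1 - \<rho>) * x $ i + \<rho> * (\<Sum>j\<in>UNIV. x $ j)" for i
  proof -
    have "(\<Sum>j\<in>UNIV. (if i = j then 1 else \<rho>) * x $ j)
        = (\<Sum>j\<in>UNIV. (if i = j then (1 - \<rho>) * x $ j else 0) + \<rho> * x $ j)"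
      by (intro sum.cong) (auto simp: algebra_simps)
    then show ?thesis by (simp add: sum.distrib sum_distrib_left)
  qed
  then show ?thesis by (simp add: equicorrelated_def matrix_vector_mult_def)
qed

lemma inner_equicorrelated_mult_vec:
  "x \<bullet> (equicorrelated \<rho> *v y)
    = (1 - \<rho>) * (x \<bullet> y) + \<rho> * (\<Sum>j\<in>UNIV. x $ j) * (\<Sum>j\<in>UNIV. y $ j)"
proof -
  have "x \<bullet> (equicorrelated \<rho> *v y)
      = (\<Sum>i\<in>UNIV. (1 - \<rho>) * (x $ i * y $ i) + x $ i * (\<rho> * (\<Sum>j\<in>UNIV. y $ j)))"
    unfolding inner_vec_def equicorrelated_mult_vec by (intro sum.cong) (auto simp: distrib_left)
  also have "\<dots> = (1 - \<rho>) * (x \<bullet> y) + (\<Sum>j\<in>UNIV. x $ j) * (\<rho> * (\<Sum>j\<in>UNIV. y $ j))"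
    by (simp add: sum.distrib sum_distrib_left[symmetric] sum_distrib_right[symmetric] inner_vec_def)
  finally show ?thesis by simp
qed

lemma invertible_equicorrelated:
  assumes "0 \<le> \<rho>" "\<rho> < 1"
  shows "invertible (equicorrelated \<rho> :: real^'n^'n::finite)"
proof -
  have "x = 0" if x: "equicorrelated \<rho> *v x = 0" for x :: "real^'n"
  proof -
    have i: "(1 - \<rho>) * x $ i + \<rho> * (\<Sum>j\<in>UNIV. x $ j) = 0" for i
      using x unfolding equicorrelated_mult_vec by (simp add: vec_eq_iff)
    have "(1 - \<rho> + \<rho> * CARD('n)) * (\<Sum>j\<in>UNIV. x $ j)
        = (\<Sum>i\<in>UNIV. (1 - \<rho>) * x $ i + \<rho> * (\<Sum>j\<in>UNIV. x $ j))"
      by (simp add: sum.distrib sum_distrib_left[symmetric] distrib_right)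
    also have "\<dots> = 0"
      using i by simp
    finally have "(1 - \<rho> + \<rho> * CARD('n)) * (\<Sum>j\<in>UNIV. x $ j) = 0" .
    moreover have "1 - \<rho> + \<rho> * CARD('n) > 0"
      using assms by (intro add_pos_nonneg) auto
    ultimately have "(\<Sum>j\<in>UNIV. x $ j) = 0" by simp
    with i assms show ?thesis by (simp add: vec_eq_iff)
  qed
  then show ?thesis
    by (metis invertible_left_inverse matrix_left_invertible_ker)
qed

lemma mvn_density_translate:
  "mvn_density (a + b) S (z + b) = mvn_density a S z"
  by (simp add: mvn_density_def)

locale equicorrelation =
  fixes \<rho> :: real and dimension :: "'n::finite itself"
  assumes \<rho>: "0 \<le> \<rho>" "\<rho> < 1"
begin

definition precision :: "real^'n^'n" where
  "precision = matrix_inv (equicorrelated \<rho>)"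

lemma precision_mult_vec_cancel: "precision *v (equicorrelated \<rho> *v x) = x"
  and mult_precision_vec_cancel: "equicorrelated \<rho> *v (precision *v x) = x"
proof -
  have "\<exists>B. equicorrelated \<rho> ** B = mat 1 \<and> B ** equicorrelated \<rho> = (mat 1 :: real^'n^'n)"
    using invertible_equicorrelated[OF \<rho>] by (simp add: invertible_def)
  then have "equicorrelated \<rho> ** precision = mat 1 \<and> precision ** equicorrelated \<rho> = mat 1"
    unfolding precision_def matrix_inv_def by (rule someI_ex)
  then show "precision *v (equicorrelated \<rho> *v x) = x" "equicorrelated \<rho> *v (precision *v x) = x"
    by (simp_all add: matrix_vector_mul_assoc)
qed

lemma inner_precision_commute: "x \<bullet> (precision *v y) = y \<bullet> (precision *v x)"
proof -
  have sym: "u \<bullet> (equicorrelated \<rho> *v w) = (equicorrelated \<rho> *v u) \<bullet> w" for u w :: "real^'n"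
    unfolding inner_commute[of "equicorrelated \<rho> *v u"] inner_equicorrelated_mult_vec
    by (simp add: inner_commute)
  show ?thesis
    using sym[of "precision *v x" "precision *v y"] by (simp add: mult_precision_vec_cancel inner_commute)
qed

lemma quadratic_precision_diff:
  "(x - y) \<bullet> (precision *v (x - y)) = x \<bullet> (precision *v x) - 2 * (x \<bullet> (precision *v y)) + y \<bullet> (precision *v y)"
  using inner_precision_commute[of x y]
  by (simp add: inner_diff_left inner_diff_right matrix_vector_mult_diff_distrib)

lemma mvn_density_exp:
  obtains K where "\<And>a x. mvn_density a (equicorrelated \<rho>) (x :: real^'n)
    = exp (- ((x - a) \<bullet> (precision *v (x - a))) / 2) / K"
  by (rule that) (simp add: mvn_density_def precision_def)

lemma mvn_density_swap_le:
  fixes z :: "real^'n"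
  assumes nonneg: "\<And>x. 0 \<le> mvn_density 0 (equicorrelated \<rho>) (x :: real^'n)"
    and t: "t i" "\<not> t j" and z: "\<mu> * z $ j \<le> \<mu> * z $ i"
  shows "mvn_density (\<mu> *\<^sub>R (\<chi> k. of_bool (t (Transposition.transpose i j k)))) (equicorrelated \<rho>) z
       \<le> mvn_density (\<mu> *\<^sub>R (\<chi> k. of_bool (t k))) (equicorrelated \<rho>) z"
proof -
  obtain K where K: "\<And>a x. mvn_density a (equicorrelated \<rho>) (x :: real^'n)
    = exp (- ((x - a) \<bullet> (precision *v (x - a))) / 2) / K"
    using mvn_density_exp by blast
  have "0 \<le> K" using nonneg[of 0] by (simp add: K zero_le_divide_iff)
  define t' :: "real^'n" where "t' = (\<chi> k. of_bool (t (Transposition.transpose i j k)))"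
  define d :: "real^'n" where "d = axis i 1 - axis j 1"
  have ne: "i \<noteq> j" using t by auto
  have t_eq: "(\<chi> k. of_bool (t k)) = t' + d"
    using t by (auto simp: t'_def d_def vec_eq_iff axis_def transpose_def)
  have "equicorrelated \<rho> *v d = (1 - \<rho>) *\<^sub>R d"
    using ne by (simp add: equicorrelated_mult_vec vec_eq_iff d_def axis_def sum_subtractf)
  then have "precision *v ((1 - \<rho>) *\<^sub>R d) = d"
    using precision_mult_vec_cancel[of d] by simp
  then have "(1 - \<rho>) *\<^sub>R (precision *v d) = d"
    by (simp add: matrix_vector_mult_scaleR)
  then have "(1 / (1 - \<rho>)) *\<^sub>R ((1 - \<rho>) *\<^sub>R (precision *v d)) = (1 / (1 - \<rho>)) *\<^sub>R d"
    by simp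
  then have precision_d: "precision *v d = (1 / (1 - \<rho>)) *\<^sub>R d"
    using \<rho> by simp
  define x where "x = z - \<mu> *\<^sub>R t'"
  have xd: "x \<bullet> d = z $ i - z $ j + \<mu>"
    using t by (simp add: x_def d_def inner_diff_right inner_axis t'_def)
  have dd: "d \<bullet> d = 2"
    using ne by (simp add: d_def inner_diff_right inner_axis) (simp add: axis_def)
  have "(x - \<mu> *\<^sub>R d) \<bullet> (precision *v (x - \<mu> *\<^sub>R d))
      = x \<bullet> (precision *v x) - 2 * \<mu> * (z $ i - z $ j) / (1 - \<rho>)"
    unfolding quadratic_precision_diff using \<rho>
    by (simp add: matrix_vector_mult_scaleR precision_d xd dd divide_simps) (simp add: algebra_simps)
  moreover have "0 \<le> 2 * \<mu> * (z $ i - z $ j) / (1 - \<rho>)"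
    using z \<rho> by (simp add: algebra_simps)
  ultimately have "(x - \<mu> *\<^sub>R d) \<bullet> (precision *v (x - \<mu> *\<^sub>R d)) \<le> x \<bullet> (precision *v x)" by linarith
  moreover have "z - \<mu> *\<^sub>R (t' + d) = x - \<mu> *\<^sub>R d"
    by (simp add: x_def algebra_simps)
  ultimately show ?thesis
    unfolding K t_eq t'_def[symmetric]
    using \<open>0 \<le> K\<close> by (intro divide_right_mono) (simp_all add: x_def[symmetric])
qed

lemma mvn_density_tilt:
  fixes z :: "real^'n"
  shows "mvn_density (s *\<^sub>R (equicorrelated \<rho> *v axis i 1)) (equicorrelated \<rho>) z
       = exp (s * z $ i - s\<^sup>2 / 2) * mvn_density 0 (equicorrelated \<rho>) z"
proof -
  obtain K where K: "\<And>a x. mvn_density a (equicorrelated \<rho>) (x :: real^'n)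
    = exp (- ((x - a) \<bullet> (precision *v (x - a))) / 2) / K"
    using mvn_density_exp by blast
  define v :: "real^'n" where "v = equicorrelated \<rho> *v axis i 1"
  have precision_v: "precision *v v = axis i 1" unfolding v_def by (rule precision_mult_vec_cancel)
  have vi: "v $ i = 1" by (simp add: v_def equicorrelated_mult_vec axis_def)
  have "(z - s *\<^sub>R v) \<bullet> (precision *v (z - s *\<^sub>R v)) = z \<bullet> (precision *v z) - 2 * s * z $ i + s\<^sup>2"
    unfolding quadratic_precision_diff
    by (simp add: matrix_vector_mult_scaleR precision_v inner_axis vi power2_eq_square)
  then have "- ((z - s *\<^sub>R v) \<bullet> (precision *v (z - s *\<^sub>R v))) / 2 = s * z $ i - s\<^sup>2 / 2 + - (z \<bullet> (precision *v z)) / 2"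
    by (simp add: field_simps)
  then show ?thesis
    unfolding K v_def[symmetric] by (simp only: exp_add) simp
qed

end

declare borel_measurable_nth [measurable]

lemma measurable_mvn_density [measurable]: "mvn_density a S \<in> borel_measurable borel"
  unfolding mvn_density_def divide_inverse[of "exp _"]
  by (intro borel_measurable_continuous_onI continuous_intros
      continuous_on_compose2[OF linear_continuous_on[OF matrix_vector_mul_bounded_linear]]) auto

lemma nn_integral_lborel_translate:
  fixes b :: "'a::euclidean_space"
  assumes [measurable]: "g \<in> borel_measurable borel"
  shows "(\<integral>\<^sup>+z. g z \<partial>lborel) = (\<integral>\<^sup>+z. g (z + b) \<partial>lborel)"
  by (subst lborel_distr_plus[of b, symmetric], subst nn_integral_distr) (auto simp: add.commute)

lemma nn_integral_mvn_density_component_cong: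
  fixes a a' :: "real^'n::finite"
  assumes [measurable]: "g \<in> borel_measurable borel" and eq: "a $ i = a' $ i"
  shows "(\<integral>\<^sup>+z. g (z $ i) * ennreal (mvn_density a S z) \<partial>lborel)
       = (\<integral>\<^sup>+z. g (z $ i) * ennreal (mvn_density a' S z) \<partial>lborel)"
proof -
  have "(\<integral>\<^sup>+z. g (z $ i) * ennreal (mvn_density a S z) \<partial>lborel)
      = (\<integral>\<^sup>+z. g ((z + (a - a')) $ i) * ennreal (mvn_density a S (z + (a - a'))) \<partial>lborel)"
    by (rule nn_integral_lborel_translate) measurable
  also have "\<dots> = (\<integral>\<^sup>+z. g (z $ i) * ennreal (mvn_density a' S z) \<partial>lborel)"
    using mvn_density_translate[of a' "a - a'" S] by (simp add: eq)
  finally show ?thesis .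
qed

subsection \<open>Conditional densities and independence\<close>

lemma (in prob_space) nn_integral_has_cond_density:
  fixes X :: "'a \<Rightarrow> 'b::euclidean_space"
  assumes f: "has_cond_density M P X f" and P: "{\<omega>\<in>space M. P \<omega>} \<in> events"
    and X [measurable]: "random_variable borel X"
    and g [measurable]: "g \<in> borel_measurable borel"
  shows "(\<integral>\<^sup>+\<omega>. g (X \<omega>) * indicator {\<omega>\<in>space M. P \<omega>} \<omega> \<partial>M)
       = ennreal (\<P>(\<omega> in M. P \<omega>)) * (\<integral>\<^sup>+x. ennreal (f x) * g x \<partial>lborel)"
proof (cases "\<P>(\<omega> in M. P \<omega>) = 0")
  case True
  then have "AE \<omega> in M. \<omega> \<notin> {\<omega>\<in>space M. P \<omega>}"
    using P prob_eq_0 by blast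
  then have "(\<integral>\<^sup>+\<omega>. g (X \<omega>) * indicator {\<omega>\<in>space M. P \<omega>} \<omega> \<partial>M) = (\<integral>\<^sup>+\<omega>. 0 \<partial>M)"
    by (intro nn_integral_cong_AE) auto
  with True show ?thesis by simp
next
  case False
  let ?A = "{\<omega>\<in>space M. P \<omega>}"
  have pos: "0 < prob ?A" using False by (simp add: zero_less_measure_iff)
  then have "distributed (uniform_measure M ?A) lborel X (\<lambda>x. ennreal (f x))"
    using f by (simp add: has_cond_density_def)
  then have "(\<integral>\<^sup>+x. ennreal (f x) * g x \<partial>lborel) = (\<integral>\<^sup>+\<omega>. g (X \<omega>) \<partial>uniform_measure M ?A)"
    by (rule distributed_nn_integral) simp
  also have "\<dots> = (\<integral>\<^sup>+\<omega>. g (X \<omega>) * indicator ?A \<omega> \<partial>M) / ennreal (prob ?A)"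
    unfolding emeasure_eq_measure[symmetric] by (rule nn_integral_uniform_measure) (use P in auto)
  finally have "ennreal (prob ?A) * (\<integral>\<^sup>+x. ennreal (f x) * g x \<partial>lborel)
      = ennreal (prob ?A) * ((\<integral>\<^sup>+\<omega>. g (X \<omega>) * indicator ?A \<omega> \<partial>M) / ennreal (prob ?A))"
    by simp
  also have "\<dots> = (\<integral>\<^sup>+\<omega>. g (X \<omega>) * indicator ?A \<omega> \<partial>M)"
    using pos by (simp add: ennreal_times_divide mult.commute[of "ennreal (prob ?A)"] mult_divide_eq_ennreal)
  finally show ?thesis by simp
qed

lemma has_cond_density_measurable:
  assumes "has_cond_density M P X f" "0 < \<P>(\<omega> in M. P \<omega>)"
  shows "f \<in> borel_measurable borel"
proof -
  have "(\<lambda>x. ennreal (f x)) \<in> borel_measurable lborel" and 0: "\<And>x. 0 \<le> f x"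
    using assms by (auto simp: has_cond_density_def distributed_def)
  then have "(\<lambda>x. enn2real (ennreal (f x))) \<in> borel_measurable borel"
    by simp
  then show ?thesis by (simp add: 0)
qed

lemma indep_rvs_distr:
  assumes "prob_space M" and ind: "indep_rvs M S X T Y"
  shows "distr M S X \<Otimes>\<^sub>M distr M T Y = distr M (S \<Otimes>\<^sub>M T) (\<lambda>\<omega>. (X \<omega>, Y \<omega>))"
proof -
  interpret prob_space M by fact
  have X [measurable]: "X \<in> M \<rightarrow>\<^sub>M S" and Y [measurable]: "Y \<in> M \<rightarrow>\<^sub>M T"
    and i: "indep_set (sets (vimage_algebra (space M) X S)) (sets (vimage_algebra (space M) Y T))"
    using ind by (auto simp: indep_rvs_def)
  interpret PX: prob_space "distr M S X" by (rule prob_space_distr) measurable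
  interpret PY: prob_space "distr M T Y" by (rule prob_space_distr) measurable
  show ?thesis
  proof (rule pair_measure_eqI)
    show "sigma_finite_measure (distr M S X)" "sigma_finite_measure (distr M T Y)" ..
    show "sets (distr M S X \<Otimes>\<^sub>M distr M T Y) = sets (distr M (S \<Otimes>\<^sub>M T) (\<lambda>\<omega>. (X \<omega>, Y \<omega>)))"
      by (simp cong: sets_pair_measure_cong)
    fix A B assume "A \<in> sets (distr M S X)" "B \<in> sets (distr M T Y)"
    then have [measurable]: "A \<in> sets S" "B \<in> sets T" by auto
    have "prob ((X -` A \<inter> space M) \<inter> (Y -` B \<inter> space M))
        = prob (X -` A \<inter> space M) * prob (Y -` B \<inter> space M)"
      by (rule indep_setD[OF i]) (auto intro!: in_vimage_algebra)
    moreover have "(\<lambda>\<omega>. (X \<omega>, Y \<omega>)) -` (A \<times> B) \<inter> space M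
        = (X -` A \<inter> space M) \<inter> (Y -` B \<inter> space M)" by auto
    ultimately show "emeasure (distr M S X) A * emeasure (distr M T Y) B
        = emeasure (distr M (S \<Otimes>\<^sub>M T) (\<lambda>\<omega>. (X \<omega>, Y \<omega>))) (A \<times> B)"
      by (simp add: emeasure_distr emeasure_eq_measure ennreal_mult'')
  qed
qed

lemma nn_integral_indep_rvs:
  assumes "prob_space M" and ind: "indep_rvs M S X T Y"
    and f [measurable]: "f \<in> borel_measurable (S \<Otimes>\<^sub>M T)"
  shows "(\<integral>\<^sup>+\<omega>. f (X \<omega>, Y \<omega>) \<partial>M) = (\<integral>\<^sup>+y. (\<integral>\<^sup>+\<omega>. f (X \<omega>, y) \<partial>M) \<partial>distr M T Y)"
proof -
  interpret prob_space M by fact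
  have X [measurable]: "X \<in> M \<rightarrow>\<^sub>M S" and Y [measurable]: "Y \<in> M \<rightarrow>\<^sub>M T"
    using ind by (auto simp: indep_rvs_def)
  interpret PX: prob_space "distr M S X" by (rule prob_space_distr) measurable
  interpret PY: prob_space "distr M T Y" by (rule prob_space_distr) measurable
  interpret P: pair_sigma_finite "distr M S X" "distr M T Y" ..
  have "(\<integral>\<^sup>+\<omega>. f (X \<omega>, Y \<omega>) \<partial>M) = (\<integral>\<^sup>+p. f p \<partial>distr M (S \<Otimes>\<^sub>M T) (\<lambda>\<omega>. (X \<omega>, Y \<omega>)))"
    by (simp add: nn_integral_distr)
  also have "\<dots> = (\<integral>\<^sup>+p. f p \<partial>(distr M S X \<Otimes>\<^sub>M distr M T Y))"
    by (simp add: indep_rvs_distr[OF assms(1,2)])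
  also have "\<dots> = (\<integral>\<^sup>+y. (\<integral>\<^sup>+x. f (x, y) \<partial>distr M S X) \<partial>distr M T Y)"
    by (rule P.nn_integral_snd[symmetric]) simp
  also have "\<dots> = (\<integral>\<^sup>+y. (\<integral>\<^sup>+\<omega>. f (X \<omega>, y) \<partial>M) \<partial>distr M T Y)"
    by (intro nn_integral_cong nn_integral_distr) auto
  finally show ?thesis .
qed

lemma iid_bernoulli_prob:
  fixes \<theta> :: "'w \<Rightarrow> 'n::finite \<Rightarrow> bool"
  assumes "prob_space M" and iid: "iid_bernoulli M \<pi> \<theta>"
  shows "\<P>(\<omega> in M. \<theta> \<omega> = t) = (\<Prod>i\<in>UNIV. pmf (bernoulli_pmf \<pi>) (t i))"
proof -
  interpret prob_space M by fact
  have ind: "indep_vars (\<lambda>_. count_space UNIV) (\<lambda>i \<omega>. \<theta> \<omega> i) UNIV"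
    and law: "\<And>i. distr M (count_space UNIV) (\<lambda>\<omega>. \<theta> \<omega> i) = measure_pmf (bernoulli_pmf \<pi>)"
    using iid by (auto simp: iid_bernoulli_def)
  have rv: "random_variable (count_space UNIV) (\<lambda>\<omega>. \<theta> \<omega> i)" for i
    using ind by (simp add: indep_vars_def)
  have "{\<omega>\<in>space M. \<theta> \<omega> = t} = (\<Inter>i\<in>UNIV. (\<lambda>\<omega>. \<theta> \<omega> i) -` {t i} \<inter> space M)"
    by (auto simp: fun_eq_iff)
  then have "\<P>(\<omega> in M. \<theta> \<omega> = t) = (\<Prod>i\<in>UNIV. prob ((\<lambda>\<omega>. \<theta> \<omega> i) -` {t i} \<inter> space M))"
    using indep_varsD_finite[OF ind, of "\<lambda>i. {t i}"] by simp
  also have "\<dots> = (\<Prod>i\<in>UNIV. pmf (bernoulli_pmf \<pi>) (t i))"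
    using measure_distr[OF rv, of "{_}"] by (simp add: law pmf.rep_eq)
  finally show ?thesis .
qed

lemma measurable_fun_finite:
  assumes "\<And>i. Measurable.pred M (\<lambda>x. f x i)"
  shows "f \<in> M \<rightarrow>\<^sub>M count_space (UNIV :: ('n::finite \<Rightarrow> bool) set)"
proof (rule measurable_count_space_eq_countable[THEN iffD2])
  show "countable (UNIV :: ('n \<Rightarrow> bool) set)" by (rule countable_finite) simp
  have "{x\<in>space M. f x = t} \<in> sets M" for t
  proof -
    have "{x\<in>space M. f x = t} = {x\<in>space M. \<forall>i. f x i = t i}" by (auto simp: fun_eq_iff)
    also have "\<dots> \<in> sets M" using assms by measurable
    finally show ?thesis .
  qed
  moreover have "f -` {t} \<inter> space M = {x\<in>space M. f x = t}" for t by auto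
  ultimately show "f \<in> space M \<rightarrow> UNIV \<and> (\<forall>a\<in>UNIV. f -` {a} \<inter> space M \<in> sets M)" by auto
qed

subsection \<open>The two-groups model\<close>

locale two_groups_model = prob_space M + equicorrelation \<rho> "TYPE('n::finite)"
  for M :: "'w measure" and \<rho> :: real
    and \<theta> :: "'w \<Rightarrow> 'n::finite \<Rightarrow> bool" and Z :: "'w \<Rightarrow> real^'n"
    and \<pi> \<mu> :: real and f0 f1 :: "real \<Rightarrow> real" +
  assumes \<pi>: "0 \<le> \<pi>" "\<pi> \<le> 1"
    and iid: "iid_bernoulli M \<pi> \<theta>"
    and gauss: "cond_gaussian M \<mu> (equicorrelated \<rho>) \<theta> Z"
    and f0: "\<And>i. has_cond_density M (\<lambda>\<omega>. \<not> \<theta> \<omega> i) (\<lambda>\<omega>. Z \<omega> $ i) f0"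
    and f1: "\<And>i. has_cond_density M (\<lambda>\<omega>. \<theta> \<omega> i) (\<lambda>\<omega>. Z \<omega> $ i) f1"
begin

definition prior :: "('n \<Rightarrow> bool) \<Rightarrow> real" where
  "prior t = \<P>(\<omega> in M. \<theta> \<omega> = t)"

definition likelihood :: "('n \<Rightarrow> bool) \<Rightarrow> real^'n \<Rightarrow> real" where
  "likelihood t = mvn_density (\<mu> *\<^sub>R (\<chi> i. of_bool (t i))) (equicorrelated \<rho>)"

definition score :: "real \<Rightarrow> real" where
  "score = lfdr \<pi> f0 f1"

lemma Z_measurable [measurable]: "Z \<in> borel_measurable M"
  using gauss by (simp add: cond_gaussian_def)

lemma \<theta>_component_measurable [measurable]: "Measurable.pred M (\<lambda>\<omega>. \<theta> \<omega> i)"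
  using iid by (simp add: iid_bernoulli_def indep_vars_def)

lemma \<theta>_measurable [measurable]: "\<theta> \<in> M \<rightarrow>\<^sub>M count_space UNIV"
  by (rule measurable_fun_finite) measurable

lemma prior_eq: "prior t = (\<Prod>i\<in>UNIV. pmf (bernoulli_pmf \<pi>) (t i))"
  unfolding prior_def by (rule iid_bernoulli_prob[OF prob_space_axioms iid])

lemma prior_nonneg: "0 \<le> prior t"
  by (simp add: prior_def)

lemma prior_pos: "0 < \<pi> \<Longrightarrow> \<pi> < 1 \<Longrightarrow> 0 < prior t"
  unfolding prior_eq
proof (intro prod_pos ballI)
  fix i assume "0 < \<pi>" "\<pi> < 1"
  then show "0 < pmf (bernoulli_pmf \<pi>) (t i)" by (cases "t i") auto
qed

lemma prior_eq_0:
  assumes "\<pi> = 0 \<or> \<pi> = 1" "t i" "\<not> t j"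
  shows "prior t = 0"
proof -
  have "pmf (bernoulli_pmf \<pi>) (t i) = 0 \<or> pmf (bernoulli_pmf \<pi>) (t j) = 0"
    using assms by auto
  then show ?thesis unfolding prior_eq prod_zero_iff[OF finite] by blast
qed

lemma prior_comp_bij: "bij s \<Longrightarrow> prior (t \<circ> s) = prior t"
  unfolding prior_eq comp_def
  using prod.reindex_bij_betw[of s UNIV UNIV "\<lambda>i. pmf (bernoulli_pmf \<pi>) (t i)"] by simp

lemma likelihood_nonneg: "0 \<le> likelihood t z"
  using gauss by (simp add: cond_gaussian_def has_cond_density_def likelihood_def)

lemma likelihood_False: "likelihood (\<lambda>_. False) = mvn_density 0 (equicorrelated \<rho>)"
proof -
  have "\<mu> *\<^sub>R (\<chi> i. of_bool False) = (0 :: real^'n)" by (simp add: vec_eq_iff)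
  then show ?thesis by (simp only: likelihood_def)
qed

lemma likelihood_measurable [measurable]: "likelihood t \<in> borel_measurable borel"
  unfolding likelihood_def by measurable

lemma f0_nonneg: "0 \<le> f0 x" and f1_nonneg: "0 \<le> f1 x"
  using f0 f1 by (simp_all add: has_cond_density_def)

lemma prob_\<theta>_component: "\<P>(\<omega> in M. \<theta> \<omega> i) = \<pi>" "\<P>(\<omega> in M. \<not> \<theta> \<omega> i) = 1 - \<pi>"
proof -
  have rv: "random_variable (count_space UNIV) (\<lambda>\<omega>. \<theta> \<omega> i)" by measurable
  have law: "distr M (count_space UNIV) (\<lambda>\<omega>. \<theta> \<omega> i) = measure_pmf (bernoulli_pmf \<pi>)"
    using iid by (auto simp: iid_bernoulli_def)
  have "prob ((\<lambda>\<omega>. \<theta> \<omega> i) -` {b} \<inter> space M) = pmf (bernoulli_pmf \<pi>) b" for b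
    using measure_distr[OF rv, of "{b}"] by (simp add: law pmf.rep_eq)
  from this[of True] this[of False] show "\<P>(\<omega> in M. \<theta> \<omega> i) = \<pi>" "\<P>(\<omega> in M. \<not> \<theta> \<omega> i) = 1 - \<pi>"
    using \<pi> by (simp_all add: vimage_def Int_def conj_commute)
qed

lemma f0_measurable: "\<pi> < 1 \<Longrightarrow> f0 \<in> borel_measurable borel"
  using has_cond_density_measurable[OF f0] by (simp add: prob_\<theta>_component)

lemma f1_measurable: "0 < \<pi> \<Longrightarrow> f1 \<in> borel_measurable borel"
  using has_cond_density_measurable[OF f1] by (simp add: prob_\<theta>_component)

lemma score_measurable [measurable]: "score \<in> borel_measurable borel"
proof -
  have [measurable]: "(\<lambda>x. (1 - \<pi>) * f0 x) \<in> borel_measurable borel"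
    using f0_measurable \<pi> by (cases "\<pi> = 1") auto
  have [measurable]: "(\<lambda>x. \<pi> * f1 x) \<in> borel_measurable borel"
    using f1_measurable \<pi> by (cases "\<pi> = 0") auto
  show ?thesis unfolding score_def lfdr_def by measurable
qed

lemma nn_integral_theta_eq:
  assumes [measurable]: "g \<in> borel_measurable borel"
  shows "(\<integral>\<^sup>+\<omega>. g (Z \<omega>) * indicator {\<omega>\<in>space M. \<theta> \<omega> = t} \<omega> \<partial>M)
       = ennreal (prior t) * (\<integral>\<^sup>+z. ennreal (likelihood t z) * g z \<partial>lborel)"
  unfolding prior_def likelihood_def
  by (rule nn_integral_has_cond_density) (use gauss in \<open>auto simp: cond_gaussian_def\<close>)

lemma nn_integral_theta_Z:
  assumes [measurable]: "\<And>t. g t \<in> borel_measurable borel"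
  shows "(\<integral>\<^sup>+\<omega>. g (\<theta> \<omega>) (Z \<omega>) \<partial>M)
       = (\<Sum>t\<in>UNIV. ennreal (prior t) * (\<integral>\<^sup>+z. ennreal (likelihood t z) * g t z \<partial>lborel))"
proof -
  have "g (\<theta> \<omega>) (Z \<omega>) = (\<Sum>t\<in>UNIV. g t (Z \<omega>) * indicator {\<omega>\<in>space M. \<theta> \<omega> = t} \<omega>)"
    if "\<omega> \<in> space M" for \<omega>
  proof -
    have "(\<Sum>t\<in>UNIV. g t (Z \<omega>) * indicator {\<omega>\<in>space M. \<theta> \<omega> = t} \<omega>)
        = (\<Sum>t\<in>UNIV. if t = \<theta> \<omega> then g t (Z \<omega>) else 0)"
      using that by (intro sum.cong) (auto simp: indicator_def)
    then show ?thesis by simp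
  qed
  then have "(\<integral>\<^sup>+\<omega>. g (\<theta> \<omega>) (Z \<omega>) \<partial>M)
      = (\<integral>\<^sup>+\<omega>. (\<Sum>t\<in>UNIV. g t (Z \<omega>) * indicator {\<omega>\<in>space M. \<theta> \<omega> = t} \<omega>) \<partial>M)"
    by (rule nn_integral_cong)
  also have "\<dots> = (\<Sum>t\<in>UNIV. \<integral>\<^sup>+\<omega>. g t (Z \<omega>) * indicator {\<omega>\<in>space M. \<theta> \<omega> = t} \<omega> \<partial>M)"
    by (rule nn_integral_sum) measurable
  finally show ?thesis by (simp add: nn_integral_theta_eq)
qed

text \<open>The marginal law of \<open>Z\<^sub>i\<close> given \<open>\<theta> = t\<close> depends on \<open>t i\<close> only, because the density is translated
  when \<open>t\<close> changes off \<open>i\<close>.\<close>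

lemma nn_integral_likelihood_component:
  assumes [measurable]: "g \<in> borel_measurable borel"
  shows "(\<integral>\<^sup>+z. ennreal (likelihood t z) * g (z $ i) \<partial>lborel)
       = (\<integral>\<^sup>+z. ennreal (likelihood (\<lambda>_. t i) z) * g (z $ i) \<partial>lborel)"
  using nn_integral_mvn_density_component_cong[of g "\<mu> *\<^sub>R (\<chi> i. of_bool (t i))" i
      "\<mu> *\<^sub>R (\<chi> _. of_bool (t i))" "equicorrelated \<rho>"]
  by (simp add: likelihood_def mult.commute)

lemma nn_integral_likelihood_True:
  assumes [measurable]: "g \<in> borel_measurable borel"
  shows "(\<integral>\<^sup>+z. ennreal (likelihood (\<lambda>_. True) z) * g (z $ i) \<partial>lborel)
       = (\<integral>\<^sup>+z. ennreal (likelihood (\<lambda>_. False) z) * (ennreal (exp (\<mu> * z $ i - \<mu>\<^sup>2 / 2)) * g (z $ i)) \<partial>lborel)"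
proof -
  have "(\<integral>\<^sup>+z. ennreal (likelihood (\<lambda>_. True) z) * g (z $ i) \<partial>lborel)
      = (\<integral>\<^sup>+z. g (z $ i) * ennreal (mvn_density (\<mu> *\<^sub>R (equicorrelated \<rho> *v axis i 1)) (equicorrelated \<rho>) z) \<partial>lborel)"
    unfolding likelihood_def mult.commute[of _ "g _"]
    by (rule nn_integral_mvn_density_component_cong) (simp_all add: equicorrelated_mult_vec axis_def)
  also have "\<dots> = (\<integral>\<^sup>+z. ennreal (likelihood (\<lambda>_. False) z) * (ennreal (exp (\<mu> * z $ i - \<mu>\<^sup>2 / 2)) * g (z $ i)) \<partial>lborel)"
    by (intro nn_integral_cong) (simp add: mvn_density_tilt likelihood_False[symmetric] ennreal_mult likelihood_nonneg mult_ac)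
  finally show ?thesis .
qed

lemma nn_integral_component:
  assumes [measurable]: "g \<in> borel_measurable borel"
  shows "(\<integral>\<^sup>+\<omega>. g (Z \<omega> $ i) * indicator {\<omega>\<in>space M. \<theta> \<omega> i = b} \<omega> \<partial>M)
       = ennreal (\<P>(\<omega> in M. \<theta> \<omega> i = b)) * (\<integral>\<^sup>+z. ennreal (likelihood (\<lambda>_. b) z) * g (z $ i) \<partial>lborel)"
proof -
  let ?I = "\<integral>\<^sup>+z. ennreal (likelihood (\<lambda>_. b) z) * g (z $ i) \<partial>lborel"
  have "(\<integral>\<^sup>+\<omega>. g (Z \<omega> $ i) * indicator {\<omega>\<in>space M. \<theta> \<omega> i = b} \<omega> \<partial>M)
      = (\<integral>\<^sup>+\<omega>. of_bool (\<theta> \<omega> i = b) * g (Z \<omega> $ i) \<partial>M)"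
    by (intro nn_integral_cong) (auto simp: indicator_def)
  also have "\<dots> = (\<Sum>t\<in>UNIV. ennreal (prior t) * (\<integral>\<^sup>+z. ennreal (likelihood t z) * (of_bool (t i = b) * g (z $ i)) \<partial>lborel))"
    using nn_integral_theta_Z[of "\<lambda>t z. of_bool (t i = b) * g (z $ i)"] by simp
  also have "\<dots> = (\<Sum>t\<in>UNIV. ennreal (of_bool (t i = b) * prior t) * ?I)"
  proof (intro sum.cong refl)
    fix t
    show "ennreal (prior t) * (\<integral>\<^sup>+z. ennreal (likelihood t z) * (of_bool (t i = b) * g (z $ i)) \<partial>lborel)
        = ennreal (of_bool (t i = b) * prior t) * ?I"
    proof (cases "t i = b")
      case True
      have "(\<integral>\<^sup>+z. ennreal (likelihood t z) * g (z $ i) \<partial>lborel) = ?I"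
        using nn_integral_likelihood_component[OF assms, of t i] unfolding True .
      then show ?thesis unfolding True by simp
    qed simp
  qed
  also have "\<dots> = ennreal (\<Sum>t\<in>UNIV. of_bool (t i = b) * prior t) * ?I"
    by (simp add: sum_distrib_right[symmetric] sum_ennreal prior_nonneg)
  also have "(\<Sum>t\<in>UNIV. of_bool (t i = b) * prior t) = \<P>(\<omega> in M. \<theta> \<omega> i = b)"
  proof -
    have "{\<omega>\<in>space M. \<theta> \<omega> i = b} = (\<Union>t\<in>{t. t i = b}. {\<omega>\<in>space M. \<theta> \<omega> = t})" by auto
    then have "\<P>(\<omega> in M. \<theta> \<omega> i = b) = (\<Sum>t\<in>{t. t i = b}. prior t)"
      unfolding prior_def by (simp, subst finite_measure_finite_Union) (auto simp: disjoint_family_on_def)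
    also have "\<dots> = (\<Sum>t\<in>UNIV. of_bool (t i = b) * prior t)"
      by (intro sum.mono_neutral_cong_left) auto
    finally show ?thesis by simp
  qed
  finally show ?thesis .
qed

lemma f1_eq_tilt:
  assumes "0 < \<pi>" "\<pi> < 1"
  shows "AE x in lborel. f1 x = f0 x * exp (\<mu> * x - \<mu>\<^sup>2 / 2)"
proof -
  note [measurable] = f0_measurable[OF assms(2)] f1_measurable[OF assms(1)]
  fix i0 :: 'n
  define e where "e x = exp (\<mu> * x - \<mu>\<^sup>2 / 2)" for x
  have [measurable]: "e \<in> borel_measurable borel" unfolding e_def by measurable
  have cancel: "a = b" if "ennreal c * a = ennreal c * b" "0 < c" for a b c
    using that by (simp add: ennreal_mult_cancel_left)
  have 1: "(\<integral>\<^sup>+x. ennreal (f1 x) * g x \<partial>lborel) = (\<integral>\<^sup>+z. ennreal (likelihood (\<lambda>_. True) z) * g (z $ i0) \<partial>lborel)"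
    if [measurable]: "g \<in> borel_measurable borel" for g
  proof (rule cancel)
    show "ennreal \<pi> * (\<integral>\<^sup>+x. ennreal (f1 x) * g x \<partial>lborel)
        = ennreal \<pi> * (\<integral>\<^sup>+z. ennreal (likelihood (\<lambda>_. True) z) * g (z $ i0) \<partial>lborel)"
      using nn_integral_component[of g i0 True] nn_integral_has_cond_density[OF f1[of i0], of g]
      by (simp add: prob_\<theta>_component)
  qed (use assms in simp)
  have 0: "(\<integral>\<^sup>+x. ennreal (f0 x) * g x \<partial>lborel) = (\<integral>\<^sup>+z. ennreal (likelihood (\<lambda>_. False) z) * g (z $ i0) \<partial>lborel)"
    if [measurable]: "g \<in> borel_measurable borel" for g
  proof (rule cancel)
    show "ennreal (1 - \<pi>) * (\<integral>\<^sup>+x. ennreal (f0 x) * g x \<partial>lborel)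
        = ennreal (1 - \<pi>) * (\<integral>\<^sup>+z. ennreal (likelihood (\<lambda>_. False) z) * g (z $ i0) \<partial>lborel)"
      using nn_integral_component[of g i0 False] nn_integral_has_cond_density[OF f0[of i0], of g]
      by (simp add: prob_\<theta>_component)
  qed (use assms in simp)
  have "AE x in lborel. ennreal (f1 x) = ennreal (f0 x) * ennreal (e x)"
  proof (rule sigma_finite_measure.density_unique2[OF sigma_finite_lborel])
    fix B :: "real set" assume "B \<in> sets lborel"
    then have [measurable]: "B \<in> sets borel" by simp
    have "(\<integral>\<^sup>+x\<in>B. ennreal (f1 x) \<partial>lborel)
        = (\<integral>\<^sup>+z. ennreal (likelihood (\<lambda>_. False) z) * (ennreal (e (z $ i0)) * indicator B (z $ i0)) \<partial>lborel)"
      by (simp add: 1 nn_integral_likelihood_True e_def)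
    also have "\<dots> = (\<integral>\<^sup>+x. ennreal (f0 x) * (ennreal (e x) * indicator B x) \<partial>lborel)"
      by (rule 0[symmetric]) measurable
    finally show "(\<integral>\<^sup>+x\<in>B. ennreal (f1 x) \<partial>lborel) = (\<integral>\<^sup>+x\<in>B. ennreal (f0 x) * ennreal (e x) \<partial>lborel)"
      by (simp add: mult.assoc)
  qed measurable
  then show ?thesis
    by eventually_elim (simp add: ennreal_mult[symmetric] f0_nonneg f1_nonneg e_def)
qed

definition regular :: "real \<Rightarrow> bool" where
  "regular x \<longleftrightarrow> 0 < f0 x \<and> f1 x = f0 x * exp (\<mu> * x - \<mu>\<^sup>2 / 2)"

lemma score_le_iff:
  assumes "0 < \<pi>" "\<pi> < 1" "regular x" "regular y"
  shows "score x \<le> score y \<longleftrightarrow> \<mu> * y \<le> \<mu> * x"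
proof -
  define L where "L x = exp (\<mu> * x - \<mu>\<^sup>2 / 2)" for x
  have score: "score x = (1 - \<pi>) / ((1 - \<pi>) + \<pi> * L x)" if "regular x" for x
  proof -
    have "score x = (f0 x * (1 - \<pi>)) / (f0 x * ((1 - \<pi>) + \<pi> * L x))"
      using that by (simp add: regular_def score_def lfdr_def L_def algebra_simps)
    then show ?thesis using that by (simp add: regular_def)
  qed
  have pos: "0 < (1 - \<pi>) + \<pi> * L x" for x
    using assms by (intro add_pos_pos mult_pos_pos) (auto simp: L_def)
  have "score x \<le> score y \<longleftrightarrow> (1 - \<pi>) + \<pi> * L y \<le> (1 - \<pi>) + \<pi> * L x"
    using assms pos[of x] pos[of y] by (simp add: score divide_le_eq le_divide_eq)
  also have "\<dots> \<longleftrightarrow> \<mu> * y \<le> \<mu> * x" using assms by (simp add: L_def)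
  finally show ?thesis .
qed

lemma AE_regular:
  assumes "0 < \<pi>" "\<pi> < 1"
  shows "AE \<omega> in M. \<forall>i. regular (Z \<omega> $ i)"
proof -
  note [measurable] = f0_measurable[OF assms(2)] f1_measurable[OF assms(1)]
  have [measurable]: "Measurable.pred borel regular" unfolding regular_def by measurable
  have "AE \<omega> in M. regular (Z \<omega> $ i)" for i
  proof -
    let ?g = "\<lambda>x. of_bool (\<not> regular x) :: ennreal"
    have zero0: "(\<integral>\<^sup>+x. ennreal (f0 x) * ?g x \<partial>lborel) = (\<integral>\<^sup>+(x::real). 0 \<partial>lborel)"
      by (rule nn_integral_cong_AE) (use f1_eq_tilt[OF assms] f0_nonneg in \<open>auto simp: regular_def less_le\<close>)
    have zero1: "(\<integral>\<^sup>+x. ennreal (f1 x) * ?g x \<partial>lborel) = (\<integral>\<^sup>+(x::real). 0 \<partial>lborel)"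
      by (rule nn_integral_cong_AE) (use f1_eq_tilt[OF assms] f0_nonneg in \<open>auto simp: regular_def less_le\<close>)
    have "(\<integral>\<^sup>+\<omega>. ?g (Z \<omega> $ i) \<partial>M)
        = (\<integral>\<^sup>+\<omega>. ?g (Z \<omega> $ i) * indicator {\<omega>\<in>space M. \<not> \<theta> \<omega> i} \<omega>
            + ?g (Z \<omega> $ i) * indicator {\<omega>\<in>space M. \<theta> \<omega> i} \<omega> \<partial>M)"
      by (intro nn_integral_cong) (auto simp: indicator_def)
    also have "\<dots> = 0"
      by (subst nn_integral_add)
        (use nn_integral_has_cond_density[OF f0[of i], of ?g] nn_integral_has_cond_density[OF f1[of i], of ?g]
          in \<open>simp_all add: zero0 zero1\<close>)
    finally have "AE \<omega> in M. ?g (Z \<omega> $ i) = 0"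
      by (subst (asm) nn_integral_0_iff_AE) auto
    then show ?thesis by (auto simp: of_bool_def split: if_splits)
  qed
  then show ?thesis by (rule eventually_all_finite)
qed

lemma AE_swapping_monotone:
  "AE z in lborel. swapping_monotone (\<lambda>i. score (z $ i)) (\<lambda>t. prior t * likelihood t z)"
proof (cases "0 < \<pi> \<and> \<pi> < 1")
  case False
  then have deg: "\<pi> = 0 \<or> \<pi> = 1" using \<pi> by auto
  have "swapping_monotone (\<lambda>i. score (z $ i)) (\<lambda>t. prior t * likelihood t z)" for z
    unfolding swapping_monotone_def
    by (auto simp: prior_eq_0[OF deg] prior_comp_bij)
  then show ?thesis by simp
next
  case True
  note [measurable] = f0_measurable[OF conjunct2[OF True]] f1_measurable[OF conjunct1[OF True]]
  have [measurable]: "Measurable.pred borel regular" unfolding regular_def by measurable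
  let ?g = "\<lambda>z. of_bool (\<not> (\<forall>i. regular (z $ i))) :: ennreal"
  have regular: "AE z in lborel. (\<forall>i. regular (z $ i)) \<or> likelihood t z = 0" for t
  proof -
    have "ennreal (prior t) * (\<integral>\<^sup>+z. ennreal (likelihood t z) * ?g z \<partial>lborel)
        = (\<integral>\<^sup>+\<omega>. ?g (Z \<omega>) * indicator {\<omega>\<in>space M. \<theta> \<omega> = t} \<omega> \<partial>M)"
      by (rule nn_integral_theta_eq[symmetric]) measurable
    also have "\<dots> = (\<integral>\<^sup>+\<omega>. 0 \<partial>M)"
      by (rule nn_integral_cong_AE) (use AE_regular True in auto)
    finally have "(\<integral>\<^sup>+z. ennreal (likelihood t z) * ?g z \<partial>lborel) = 0"
      using prior_pos[of t] True by simp
    then have "AE z in lborel. ennreal (likelihood t z) * ?g z = 0"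
      by (subst (asm) nn_integral_0_iff_AE) auto
    then show ?thesis
      by eventually_elim (use likelihood_nonneg[of t] in \<open>auto simp: of_bool_def ennreal_eq_0_iff intro: antisym split: if_splits\<close>)
  qed
  then have "AE z in lborel. \<forall>t. (\<forall>i. regular (z $ i)) \<or> likelihood t z = 0"
    by (rule eventually_all_finite)
  then show ?thesis
  proof eventually_elim
    fix z assume z: "\<forall>t. (\<forall>i. regular (z $ i)) \<or> likelihood t z = 0"
    show "swapping_monotone (\<lambda>i. score (z $ i)) (\<lambda>t. prior t * likelihood t z)"
      unfolding swapping_monotone_def
    proof (intro allI impI)
      fix i j t assume score: "score (z $ i) \<le> score (z $ j)" and t: "t i" "\<not> t j"
      have prior: "prior (t \<circ> Transposition.transpose i j) = prior t" by (rule prior_comp_bij) simp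
      have "likelihood (t \<circ> Transposition.transpose i j) z \<le> likelihood t z"
      proof (cases "\<forall>i. regular (z $ i)")
        case g: True
        then have "\<mu> * z $ j \<le> \<mu> * z $ i" using score score_le_iff True by blast
        then show ?thesis
          unfolding likelihood_def comp_def
            by (intro mvn_density_swap_le t) (auto simp: likelihood_False[symmetric] likelihood_nonneg)
      next
        case False
        then have "likelihood t z = 0" for t using z by blast
        then show ?thesis by simp
      qed
      then show "prior (t \<circ> Transposition.transpose i j) * likelihood (t \<circ> Transposition.transpose i j) z \<le> prior t * likelihood t z"
        unfolding prior by (rule mult_left_mono) (rule prior_nonneg)
    qed
  qed
qed

end

lemma measurable_pred_card_less:
  fixes P :: "'b \<Rightarrow> 'n::finite \<Rightarrow> bool" and Q :: "'b \<Rightarrow> 'm::finite \<Rightarrow> bool"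
  assumes [measurable]: "\<And>i. Measurable.pred M (\<lambda>x. P x i)" "\<And>i. Measurable.pred M (\<lambda>x. Q x i)"
  shows "Measurable.pred M (\<lambda>x. card {i. P x i} < card {i. Q x i})"
proof -
  have "(\<lambda>x. card {i. P x i} < card {i. Q x i})
      = (\<lambda>x. (\<Sum>i\<in>UNIV. of_bool (P x i) :: real) < (\<Sum>i\<in>UNIV. of_bool (Q x i)))"
    by (simp add: of_bool_def sum.If_cases)
  also have "Measurable.pred M \<dots>" by measurable
  finally show ?thesis .
qed

lemma measurable_binary_finite:
  fixes f g :: "'b \<Rightarrow> 'n::finite \<Rightarrow> bool"
  assumes "f \<in> M \<rightarrow>\<^sub>M count_space UNIV" "g \<in> M \<rightarrow>\<^sub>M count_space UNIV"
  shows "(\<lambda>x. h (f x) (g x)) \<in> M \<rightarrow>\<^sub>M count_space UNIV"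
proof -
  have cs: "count_space UNIV \<Otimes>\<^sub>M count_space UNIV
      = (count_space UNIV :: (('n \<Rightarrow> bool) \<times> ('n \<Rightarrow> bool)) measure)"
    by (subst pair_measure_countable) (auto simp: countable_finite)
  have "(\<lambda>x. (f x, g x)) \<in> M \<rightarrow>\<^sub>M count_space UNIV"
    using measurable_Pair[OF assms] by (simp only: cs)
  from measurable_compose[OF this, of "case_prod h" "count_space UNIV"] show ?thesis by simp
qed

lemma (in two_groups_model) nn_integral_rule:
  fixes h :: "('n \<Rightarrow> bool) \<Rightarrow> ('n \<Rightarrow> bool) \<Rightarrow> real"
  assumes ind: "indep_rvs M (count_space UNIV \<Otimes>\<^sub>M borel) (\<lambda>\<omega>. (\<theta> \<omega>, Z \<omega>)) N U"
    and d [measurable]: "d \<in> borel \<Otimes>\<^sub>M N \<rightarrow>\<^sub>M count_space UNIV"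
    and h: "\<And>t r. 0 \<le> h t r"
  shows "(\<integral>\<^sup>+\<omega>. ennreal (h (\<theta> \<omega>) (d (Z \<omega>, U \<omega>))) \<partial>M)
       = (\<integral>\<^sup>+u. (\<integral>\<^sup>+z. ennreal (\<Sum>t\<in>UNIV. prior t * likelihood t z * h t (d (z, u))) \<partial>lborel) \<partial>distr M N U)"
proof -
  define F where "F x = ennreal (h (fst (fst x)) (d (snd (fst x), snd x)))" for x
  have "(\<lambda>x. h (fst (fst x)) (d (snd (fst x), snd x)))
      \<in> (count_space UNIV \<Otimes>\<^sub>M borel) \<Otimes>\<^sub>M N \<rightarrow>\<^sub>M count_space UNIV"
    by (rule measurable_binary_finite[where f = "\<lambda>x. fst (fst x)" and h = h]) measurable
  then have F: "F \<in> borel_measurable ((count_space UNIV \<Otimes>\<^sub>M borel) \<Otimes>\<^sub>M N)"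
    unfolding F_def by (rule measurable_compose) simp
  have "(\<integral>\<^sup>+\<omega>. ennreal (h (\<theta> \<omega>) (d (Z \<omega>, U \<omega>))) \<partial>M)
      = (\<integral>\<^sup>+u. (\<integral>\<^sup>+\<omega>. ennreal (h (\<theta> \<omega>) (d (Z \<omega>, u))) \<partial>M) \<partial>distr M N U)"
    using nn_integral_indep_rvs[OF prob_space_axioms ind F] by (simp add: F_def)
  also have "\<dots> = (\<integral>\<^sup>+u. (\<integral>\<^sup>+z. ennreal (\<Sum>t\<in>UNIV. prior t * likelihood t z * h t (d (z, u))) \<partial>lborel) \<partial>distr M N U)"
  proof (rule nn_integral_cong)
    fix u assume "u \<in> space (distr M N U)"
    then have u: "u \<in> space N" by simp
    have [measurable]: "(\<lambda>z. d (z, u)) \<in> borel \<rightarrow>\<^sub>M count_space UNIV"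
      using u by measurable
    have hm [measurable]: "(\<lambda>z. h t (d (z, u))) \<in> borel_measurable borel" for t
      by (rule measurable_compose[where N = "count_space UNIV"]) measurable
    have "(\<integral>\<^sup>+\<omega>. ennreal (h (\<theta> \<omega>) (d (Z \<omega>, u))) \<partial>M)
        = (\<Sum>t\<in>UNIV. ennreal (prior t) * (\<integral>\<^sup>+z. ennreal (likelihood t z) * ennreal (h t (d (z, u))) \<partial>lborel))"
      using nn_integral_theta_Z[of "\<lambda>t z. ennreal (h t (d (z, u)))"] by simp
    also have "\<dots> = (\<integral>\<^sup>+z. (\<Sum>t\<in>UNIV. ennreal (prior t) * (ennreal (likelihood t z) * ennreal (h t (d (z, u))))) \<partial>lborel)"
      by (subst nn_integral_sum) (simp_all add: nn_integral_cmult)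
    also have "\<dots> = (\<integral>\<^sup>+z. ennreal (\<Sum>t\<in>UNIV. prior t * likelihood t z * h t (d (z, u))) \<partial>lborel)"
      by (simp add: sum_ennreal[symmetric] prior_nonneg likelihood_nonneg h ennreal_mult mult.assoc)
    finally show "(\<integral>\<^sup>+\<omega>. ennreal (h (\<theta> \<omega>) (d (Z \<omega>, u))) \<partial>M)
        = (\<integral>\<^sup>+z. ennreal (\<Sum>t\<in>UNIV. prior t * likelihood t z * h t (d (z, u))) \<partial>lborel)" .
  qed
  finally show ?thesis .
qed

definition (in two_groups_model) sorted_rule :: "((real^'n) \<times> 'u \<Rightarrow> 'n \<Rightarrow> bool) \<Rightarrow> (real^'n) \<times> 'u \<Rightarrow> 'n \<Rightarrow> bool" where
  "sorted_rule d x i \<longleftrightarrow> position (\<lambda>i. score (fst x $ i)) i < card {i. d x i}"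

context two_groups_model
begin

lemma sorted_rule_measurable:
  assumes d: "d \<in> borel \<Otimes>\<^sub>M N \<rightarrow>\<^sub>M count_space UNIV"
  shows "sorted_rule d \<in> borel \<Otimes>\<^sub>M N \<rightarrow>\<^sub>M count_space UNIV"
proof (rule measurable_fun_finite)
  fix i
  have [measurable]: "Measurable.pred (borel \<Otimes>\<^sub>M N) (\<lambda>x. d x j)" for j
    by (rule measurable_compose[OF d]) simp
  show "Measurable.pred (borel \<Otimes>\<^sub>M N) (\<lambda>x. sorted_rule d x i)"
    unfolding sorted_rule_def position_def precedes_def
    by (rule measurable_pred_card_less) measurable
qed

lemma sum_sorted_rule_le:
  assumes "swapping_monotone (\<lambda>i. score (z $ i)) w" and "\<And>k. antimono (G k)"
  shows "(\<Sum>t\<in>UNIV. w t * criterion G t (sorted_rule d (z, u)))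
      \<le> (\<Sum>t\<in>UNIV. w t * criterion G t (d (z, u)))"
proof (rule sum_first_le[OF assms])
  show "score (z $ i) \<le> score (z $ j)" if "sorted_rule d (z, u) i" "\<not> sorted_rule d (z, u) j" for i j
    using that position_le_imp[of "\<lambda>i. score (z $ i)" i j] by (simp add: sorted_rule_def)
  show "card {i. sorted_rule d (z, u) i} = card {i. d (z, u) i}"
    unfolding sorted_rule_def by (rule card_position_less[OF card_Collect_le])
qed

lemma nn_integral_sorted_rule_le:
  assumes ind: "indep_rvs M (count_space UNIV \<Otimes>\<^sub>M borel) (\<lambda>\<omega>. (\<theta> \<omega>, Z \<omega>)) N U"
    and d: "d \<in> borel \<Otimes>\<^sub>M N \<rightarrow>\<^sub>M count_space UNIV"
    and G: "\<And>k. antimono (G k)" "\<And>(t :: 'n \<Rightarrow> bool) r. 0 \<le> criterion G t r"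
  shows "(\<integral>\<^sup>+\<omega>. ennreal (criterion G (\<theta> \<omega>) (sorted_rule d (Z \<omega>, U \<omega>))) \<partial>M)
      \<le> (\<integral>\<^sup>+\<omega>. ennreal (criterion G (\<theta> \<omega>) (d (Z \<omega>, U \<omega>))) \<partial>M)"
  unfolding nn_integral_rule[where h = "criterion G", OF ind d G(2)]
    nn_integral_rule[where h = "criterion G", OF ind sorted_rule_measurable[OF d] G(2)]
proof (rule nn_integral_mono, rule nn_integral_mono_AE)
  fix u
  show "AE z in lborel. ennreal (\<Sum>t\<in>UNIV. prior t * likelihood t z * criterion G t (sorted_rule d (z, u)))
      \<le> ennreal (\<Sum>t\<in>UNIV. prior t * likelihood t z * criterion G t (d (z, u)))"
    using AE_swapping_monotone
    by eventually_elim (intro ennreal_leI sum_sorted_rule_le G)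
qed

end

lemma fdp_gt_criterion:
  "of_bool (fdp t r > \<gamma>) = criterion (\<lambda>k s. of_bool ((real k - real s) / max (real k) 1 > \<gamma>)) t r"
proof -
  have R: "(\<Sum>i\<in>UNIV. of_bool (r i)) = real (card {i. r i})"
    by (simp add: of_bool_def sum.If_cases)
  have "(\<Sum>i\<in>UNIV. (1 - of_bool (t i)) * of_bool (r i))
      = (\<Sum>i\<in>UNIV. of_bool (r i) - of_bool (r i \<and> t i) :: real)"
    by (intro sum.cong) auto
  also have "\<dots> = real (card {i. r i}) - real (card {i. r i \<and> t i})"
    unfolding sum_subtractf R by (simp add: of_bool_def sum.If_cases)
  finally show ?thesis unfolding fdp_def criterion_def R by simp
qed

lemma sum_true_positives:
  "(\<Sum>i\<in>UNIV. of_bool (t i) * of_bool (r i))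
    = real CARD('n) - criterion (\<lambda>k s. real CARD('n) - real s) t (r :: 'n::finite \<Rightarrow> bool)"
proof -
  have "(\<Sum>i\<in>UNIV. of_bool (t i) * of_bool (r i)) = (\<Sum>i\<in>UNIV. of_bool (r i \<and> t i) :: real)"
    by (intro sum.cong) auto
  also have "\<dots> = real (card {i. r i \<and> t i})"
    by (simp add: of_bool_def sum.If_cases)
  finally show ?thesis by (simp add: criterion_def)
qed

context two_groups_model
begin

lemma rule_measurable:
  fixes h :: "('n \<Rightarrow> bool) \<Rightarrow> ('n \<Rightarrow> bool) \<Rightarrow> 'b"
  assumes "indep_rvs M (count_space UNIV \<Otimes>\<^sub>M borel) (\<lambda>\<omega>. (\<theta> \<omega>, Z \<omega>)) N U"
    and [measurable]: "d \<in> borel \<Otimes>\<^sub>M N \<rightarrow>\<^sub>M count_space UNIV"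
  shows "(\<lambda>\<omega>. h (\<theta> \<omega>) (d (Z \<omega>, U \<omega>))) \<in> M \<rightarrow>\<^sub>M count_space UNIV"
proof -
  have [measurable]: "U \<in> M \<rightarrow>\<^sub>M N" using assms(1) by (simp add: indep_rvs_def)
  show ?thesis by (rule measurable_binary_finite[where f = \<theta> and h = h]) measurable
qed

lemma fdp_exceedance_sorted_rule_le:
  assumes ind: "indep_rvs M (count_space UNIV \<Otimes>\<^sub>M borel) (\<lambda>\<omega>. (\<theta> \<omega>, Z \<omega>)) N U"
    and d: "d \<in> borel \<Otimes>\<^sub>M N \<rightarrow>\<^sub>M count_space UNIV"
  shows "\<P>(\<omega> in M. fdp (\<theta> \<omega>) (sorted_rule d (Z \<omega>, U \<omega>)) > \<gamma>)
      \<le> \<P>(\<omega> in M. fdp (\<theta> \<omega>) (d (Z \<omega>, U \<omega>)) > \<gamma>)"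
proof -
  let ?G = "\<lambda>k s. of_bool ((real k - real s) / max (real k) 1 > \<gamma>) :: real"
  have G: "antimono (?G k)" for k
  proof (rule antimonoI)
    fix a b :: nat assume "a \<le> b"
    then have "(real k - real b) / max (real k) 1 \<le> (real k - real a) / max (real k) 1"
      by (intro divide_right_mono) auto
    then show "?G k b \<le> ?G k a" by auto
  qed
  have eq: "ennreal (\<P>(\<omega> in M. fdp (\<theta> \<omega>) (c (Z \<omega>, U \<omega>)) > \<gamma>))
      = (\<integral>\<^sup>+\<omega>. ennreal (criterion ?G (\<theta> \<omega>) (c (Z \<omega>, U \<omega>))) \<partial>M)"
    if c: "c \<in> borel \<Otimes>\<^sub>M N \<rightarrow>\<^sub>M count_space UNIV" for c
  proof -
    let ?E = "{\<omega>\<in>space M. fdp (\<theta> \<omega>) (c (Z \<omega>, U \<omega>)) > \<gamma>}"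
    have "?E \<in> events"
      using rule_measurable[OF ind c, of "\<lambda>t r. fdp t r > \<gamma>"] by simp
    then have "ennreal (prob ?E) = (\<integral>\<^sup>+\<omega>. indicator ?E \<omega> \<partial>M)"
      by (simp add: emeasure_eq_measure)
    also have "\<dots> = (\<integral>\<^sup>+\<omega>. ennreal (criterion ?G (\<theta> \<omega>) (c (Z \<omega>, U \<omega>))) \<partial>M)"
      by (intro nn_integral_cong) (auto simp: fdp_gt_criterion[symmetric] indicator_def)
    finally show ?thesis .
  qed
  have "ennreal (\<P>(\<omega> in M. fdp (\<theta> \<omega>) (sorted_rule d (Z \<omega>, U \<omega>)) > \<gamma>))
      \<le> ennreal (\<P>(\<omega> in M. fdp (\<theta> \<omega>) (d (Z \<omega>, U \<omega>)) > \<gamma>))"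
    unfolding eq[OF d] eq[OF sorted_rule_measurable[OF d]]
    by (rule nn_integral_sorted_rule_le[OF ind d G]) (simp add: criterion_def)
  then show ?thesis by simp
qed

lemma etp_sorted_rule_ge:
  assumes ind: "indep_rvs M (count_space UNIV \<Otimes>\<^sub>M borel) (\<lambda>\<omega>. (\<theta> \<omega>, Z \<omega>)) N U"
    and d: "d \<in> borel \<Otimes>\<^sub>M N \<rightarrow>\<^sub>M count_space UNIV"
  shows "etp M \<theta> (\<lambda>\<omega>. d (Z \<omega>, U \<omega>)) \<le> etp M \<theta> (\<lambda>\<omega>. sorted_rule d (Z \<omega>, U \<omega>))"
proof -
  let ?G = "\<lambda>k s. real CARD('n) - real s"
  have nonneg: "0 \<le> criterion ?G t r" for t r :: "'n \<Rightarrow> bool"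
    using card_Collect_le[of "\<lambda>i. r i \<and> t i"] by (simp add: criterion_def)
  have int: "integrable M (\<lambda>\<omega>. criterion ?G (\<theta> \<omega>) (c (Z \<omega>, U \<omega>)))"
    if c: "c \<in> borel \<Otimes>\<^sub>M N \<rightarrow>\<^sub>M count_space UNIV" for c
  proof (rule integrable_const_bound)
    show "AE \<omega> in M. norm (criterion ?G (\<theta> \<omega>) (c (Z \<omega>, U \<omega>))) \<le> real CARD('n)"
      using nonneg by (simp add: criterion_def)
    show "(\<lambda>\<omega>. criterion ?G (\<theta> \<omega>) (c (Z \<omega>, U \<omega>))) \<in> borel_measurable M"
      using measurable_compose[OF rule_measurable[OF ind c, of "criterion ?G"], of "\<lambda>x. x" borel] by simp
  qed
  have etp: "etp M \<theta> (\<lambda>\<omega>. c (Z \<omega>, U \<omega>))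
      = real CARD('n) - (\<integral>\<omega>. criterion ?G (\<theta> \<omega>) (c (Z \<omega>, U \<omega>)) \<partial>M)"
    if c: "c \<in> borel \<Otimes>\<^sub>M N \<rightarrow>\<^sub>M count_space UNIV" for c
    unfolding etp_def sum_true_positives using int[OF c] by (simp add: prob_space)
  have "ennreal (\<integral>\<omega>. criterion ?G (\<theta> \<omega>) (sorted_rule d (Z \<omega>, U \<omega>)) \<partial>M)
      \<le> ennreal (\<integral>\<omega>. criterion ?G (\<theta> \<omega>) (d (Z \<omega>, U \<omega>)) \<partial>M)"
    using nn_integral_sorted_rule_le[OF ind d, of ?G] nonneg
    by (simp add: nn_integral_eq_integral[symmetric] int d sorted_rule_measurable antimono_def)
  then have "(\<integral>\<omega>. criterion ?G (\<theta> \<omega>) (sorted_rule d (Z \<omega>, U \<omega>)) \<partial>M)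
      \<le> (\<integral>\<omega>. criterion ?G (\<theta> \<omega>) (d (Z \<omega>, U \<omega>)) \<partial>M)"
    by (subst (asm) ennreal_le_iff) (auto intro!: Bochner_Integration.integral_nonneg nonneg)
  then show ?thesis by (simp add: etp d sorted_rule_measurable)
qed

lemma lfdr_thresholding_rule_sorted_rule:
  assumes ind: "indep_rvs M (count_space UNIV \<Otimes>\<^sub>M borel) (\<lambda>\<omega>. (\<theta> \<omega>, Z \<omega>)) N U"
    and d: "d \<in> borel \<Otimes>\<^sub>M N \<rightarrow>\<^sub>M count_space UNIV"
  shows "lfdr_thresholding_rule M N \<theta> Z \<pi> f0 f1 (\<lambda>\<omega>. sorted_rule d (Z \<omega>, U \<omega>))"
  unfolding lfdr_thresholding_rule_def decision_rule_def
proof (intro conjI ballI)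
  show "\<exists>U' d'. indep_rvs M (count_space UNIV \<Otimes>\<^sub>M borel) (\<lambda>\<omega>. (\<theta> \<omega>, Z \<omega>)) N U' \<and>
      d' \<in> borel \<Otimes>\<^sub>M N \<rightarrow>\<^sub>M count_space UNIV \<and>
      (\<forall>\<omega>\<in>space M. sorted_rule d (Z \<omega>, U \<omega>) = d' (Z \<omega>, U' \<omega>))"
    using ind sorted_rule_measurable[OF d] by blast
  fix \<omega>
  show "\<exists>k\<le>CARD('n). rejects_first (\<lambda>i. lfdr \<pi> f0 f1 (Z \<omega> $ i)) k (sorted_rule d (Z \<omega>, U \<omega>))"
    using rejects_first_position[OF card_Collect_le, of "\<lambda>i. score (Z \<omega> $ i)" "d (Z \<omega>, U \<omega>)"]
      card_Collect_le[of "d (Z \<omega>, U \<omega>)"]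
    by (auto simp: sorted_rule_def[abs_def] score_def)
qed

end

theorem proposition3:
  fixes M :: "'w measure" and N :: "'u measure"
    and \<theta> :: "'w \<Rightarrow> 'n::finite \<Rightarrow> bool" and Z :: "'w \<Rightarrow> real^'n"
    and \<delta> :: "'w \<Rightarrow> 'n \<Rightarrow> bool"
    and \<gamma> \<alpha> \<pi> \<mu> \<rho> :: real and f0 f1 :: "real \<Rightarrow> real"
  assumes "prob_space M"
    and "0 < \<gamma>" "\<gamma> < 1" "0 < \<alpha>" "\<alpha> < 1"
    and "0 \<le> \<pi>" "\<pi> \<le> 1" "0 \<le> \<rho>" "\<rho> < 1"
    and "iid_bernoulli M \<pi> \<theta>"
    and "cond_gaussian M \<mu> (equicorrelated \<rho>) \<theta> Z"
    and "\<And>i. has_cond_density M (\<lambda>\<omega>. \<not> \<theta> \<omega> i) (\<lambda>\<omega>. Z \<omega> $ i) f0"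
    and "\<And>i. has_cond_density M (\<lambda>\<omega>. \<theta> \<omega> i) (\<lambda>\<omega>. Z \<omega> $ i) f1"
    and "decision_rule M N \<theta> Z \<delta>"
    and "\<P>(\<omega> in M. fdp (\<theta> \<omega>) (\<delta> \<omega>) > \<gamma>) \<le> \<alpha>"
  shows "\<exists>\<delta>'. lfdr_thresholding_rule M N \<theta> Z \<pi> f0 f1 \<delta>' \<and>
           \<P>(\<omega> in M. fdp (\<theta> \<omega>) (\<delta>' \<omega>) > \<gamma>) \<le> \<alpha> \<and>
           etp M \<theta> \<delta>' \<ge> etp M \<theta> \<delta>"
proof -
  interpret prob_space M by fact
  interpret two_groups_model M \<rho> \<theta> Z \<pi> \<mu> f0 f1
    by unfold_locales (use assms in auto)
  obtain U d where ind: "indep_rvs M (count_space UNIV \<Otimes>\<^sub>M borel) (\<lambda>\<omega>. (\<theta> \<omega>, Z \<omega>)) N U"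
    and d: "d \<in> borel \<Otimes>\<^sub>M N \<rightarrow>\<^sub>M count_space UNIV"
    and \<delta>: "\<forall>\<omega>\<in>space M. \<delta> \<omega> = d (Z \<omega>, U \<omega>)"
    using assms(14) by (auto simp: decision_rule_def)
  have "{\<omega>\<in>space M. fdp (\<theta> \<omega>) (\<delta> \<omega>) > \<gamma>} = {\<omega>\<in>space M. fdp (\<theta> \<omega>) (d (Z \<omega>, U \<omega>)) > \<gamma>}"
    using \<delta> by auto
  moreover have "etp M \<theta> \<delta> = etp M \<theta> (\<lambda>\<omega>. d (Z \<omega>, U \<omega>))"
    unfolding etp_def using \<delta> by (intro Bochner_Integration.integral_cong) auto
  ultimately show ?thesis
    using lfdr_thresholding_rule_sorted_rule[OF ind d] etp_sorted_rule_ge[OF ind d]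
      fdp_exceedance_sorted_rule_le[OF ind d, of \<gamma>] assms(15)
    by (intro exI[of _ "\<lambda>\<omega>. sorted_rule d (Z \<omega>, U \<omega>)"]) auto
qed

end
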